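(* Let $m>0$, $g\in\mathbb{R}\setminus\{0\}$, let $L\ge2$ be an integer, and consider the nonlinear Su-Schrieffer-Heeger chain with $L$ unit cells and vanishing inter-cell hopping, with stability matrix $J\mathcal{L}$ of a breather as defined in the context. Let $\phi$ be a breather supported in a single unit cell $R_0$, i.e. $\phi_{(R,\alpha)}=\delta_{R,R_0}\phi_\alpha$. (1) If $|g|\ge2m$, $\phi_A^2+\phi_B^2=1$, $\phi_A\phi_B=-m/g$ and $\omega=g$, then the set of eigenvalues of $J\mathcal{L}$ is $\{0,\ \pm i\sqrt{g^2-4m^2},\ \pm i(g-m),\ \pm i(g+m)\}$. In particular, the breather is linearly stable for all $|g|\ge 2m$. (2) If $(\phi_A,\phi_B)=\frac1{\sqrt2}(1,1)$ and $\omega=-m+\frac g2$, then the set of eigenvalues of $J\mathcal{L}$ is $\{0,\ \pm i\sqrt{2m(2m+g)},\ \pm i(g/2-2m),\ \pm i g/2\}$. In particular, the breather is linearly stable for $g\ge-2m$ and linearly unstable for $g<-2m$. (3) If $(\phi_A,\phi_B)=\frac1{\sqrt2}(1,-1)$ and $\omega=m+\frac g2$, then the set of eigenvalues of $J\mathcal{L}$ is $\{0,\ \pm i\sqrt{2m(2m-g)},\ \pm i(g/2+2m),\ \pm i g/2\}$. In particular, the breather is linearly stable for $g\le2m$. Here square roots of negative numbers denote either complex square root.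
   Context: Sites are labelled $a=(R,\alpha)$ with $R\in\mathbb{Z}/L\mathbb{Z}$ and $\alpha\in\{A,B\}$. The hopping matrix (inter-cell hopping zero) is $h_{(R,\alpha),(R',\beta)}=\delta_{R,R'}h_{\alpha\beta}$ with $h_{AA}=h_{BB}=0$, $h_{AB}=h_{BA}=-m$. A (real) breather with frequency $\omega\in\mathbb{R}$ is a real vector $\phi=(\phi_a)$ with $\sum_a\phi_a^2=1$ and $\sum_b h_{ab}\phi_b+g\phi_a^3=\omega\phi_a$ for all $a$. Its stability matrix is the real $4L\times4L$ matrix $$J\mathcal{L}=\begin{pmatrix}0&-\mathcal{L}_+\\ \mathcal{L}_-&0\end{pmatrix},\qquad (\mathcal{L}_\pm)_{ab}=h_{ab}-\omega\delta_{ab}+(2\pm1)g\phi_a^2\delta_{ab}.$$ The breather is called linearly stable if all eigenvalues of $J\mathcal{L}$ lie on the imaginary axis, and linearly unstable if some eigenvalue has positive real part. *)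

theory Defs
  imports "Jordan_Normal_Form.Spectral_Radius"
begin

datatype sublattice = SubA | SubB

text \<open>The cell label \<open>R\<close> in \<open>\<int>/L\<int>\<close> is represented by its
  residue \<open>R < L\<close>; values of lattice functions at labels \<open>R \<ge> L\<close> are never used.\<close>

type_synonym site = "nat \<times> sublattice"

definition sites :: "nat \<Rightarrow> site set" where
  "sites L = {..<L} \<times> UNIV"

fun cell_hopping :: "real \<Rightarrow> sublattice \<Rightarrow> sublattice \<Rightarrow> real" where
  "cell_hopping m SubA SubA = 0"
| "cell_hopping m SubB SubB = 0"
| "cell_hopping m SubA SubB = - m"
| "cell_hopping m SubB SubA = - m"

definition hopping :: "real \<Rightarrow> site \<Rightarrow> site \<Rightarrow> real" where
  "hopping m a b = (if fst a = fst b then cell_hopping m (snd a) (snd b) else 0)"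

definition breather :: "nat \<Rightarrow> real \<Rightarrow> real \<Rightarrow> real \<Rightarrow> (site \<Rightarrow> real) \<Rightarrow> bool" where
  "breather L m g \<omega> \<phi> \<longleftrightarrow>
     (\<Sum>a\<in>sites L. (\<phi> a)\<^sup>2) = 1 \<and>
     (\<forall>a\<in>sites L. (\<Sum>b\<in>sites L. hopping m a b * \<phi> b) + g * (\<phi> a) ^ 3 = \<omega> * \<phi> a)"

text \<open>The sign \<open>s = 1\<close> gives the entries of \<open>\<L>\<^sub>+\<close>, and \<open>s = -1\<close> those of \<open>\<L>\<^sub>-\<close>.\<close>

definition lin_entry ::
    "real \<Rightarrow> real \<Rightarrow> real \<Rightarrow> real \<Rightarrow> (site \<Rightarrow> real) \<Rightarrow> site \<Rightarrow> site \<Rightarrow> real" where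
  "lin_entry s m g \<omega> \<phi> a b =
     hopping m a b - \<omega> * of_bool (a = b) + (2 + s) * g * (\<phi> a)\<^sup>2 * of_bool (a = b)"

text \<open>Matrices are indexed by numbers, so the sites are enumerated as
  \<open>(0,A), (0,B), (1,A), (1,B), \<dots>\<close>; on \<open>{..<2 * L}\<close> this is a bijection onto \<open>sites L\<close>.\<close>

definition site_of :: "nat \<Rightarrow> site" where
  "site_of i = (i div 2, if even i then SubA else SubB)"

definition lin_mat ::
    "real \<Rightarrow> nat \<Rightarrow> real \<Rightarrow> real \<Rightarrow> real \<Rightarrow> (site \<Rightarrow> real) \<Rightarrow> real mat" where
  "lin_mat s L m g \<omega> \<phi> =
     mat (2 * L) (2 * L) (\<lambda>(i, j). lin_entry s m g \<omega> \<phi> (site_of i) (site_of j))"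

definition stability_matrix ::
    "nat \<Rightarrow> real \<Rightarrow> real \<Rightarrow> real \<Rightarrow> (site \<Rightarrow> real) \<Rightarrow> real mat" where
  "stability_matrix L m g \<omega> \<phi> =
     four_block_mat
       (0\<^sub>m (2 * L) (2 * L))       (- lin_mat 1 L m g \<omega> \<phi>)
       (lin_mat (- 1) L m g \<omega> \<phi>)  (0\<^sub>m (2 * L) (2 * L))"

definition stability_spectrum ::
    "nat \<Rightarrow> real \<Rightarrow> real \<Rightarrow> real \<Rightarrow> (site \<Rightarrow> real) \<Rightarrow> complex set" where
  "stability_spectrum L m g \<omega> \<phi> =
     spectrum (map_mat complex_of_real (stability_matrix L m g \<omega> \<phi>))"

definition linearly_stable ::
    "nat \<Rightarrow> real \<Rightarrow> real \<Rightarrow> real \<Rightarrow> (site \<Rightarrow> real) \<Rightarrow> bool" where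
  "linearly_stable L m g \<omega> \<phi> \<longleftrightarrow> (\<forall>z\<in>stability_spectrum L m g \<omega> \<phi>. Re z = 0)"

definition linearly_unstable ::
    "nat \<Rightarrow> real \<Rightarrow> real \<Rightarrow> real \<Rightarrow> (site \<Rightarrow> real) \<Rightarrow> bool" where
  "linearly_unstable L m g \<omega> \<phi> \<longleftrightarrow> (\<exists>z\<in>stability_spectrum L m g \<omega> \<phi>. Re z > 0)"

end

theory Submission
  imports Defs
begin

text \<open>Since the inter-cell hopping vanishes, the linearisation decouples into \<open>4 \<times> 4\<close> blocks, one
  per unit cell. Eliminating half of the unknowns, \<open>z\<close> is an eigenvalue of a block iff \<open>z\<^sup>2\<close> is an
  eigenvalue of the \<open>2 \<times> 2\<close> matrix \<open>- \<L>\<^sub>+ \<L>\<^sub>-\<close> of the cell. On an empty cell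
  \<open>\<L>\<^sub>+ = \<L>\<^sub>-\<close> has eigenvalues \<open>\<plusminus> m - \<omega>\<close>; on the occupied cell \<open>\<L>\<^sub>-\<close> annihilates the
  breather, so only the trace of \<open>\<L>\<^sub>+ \<L>\<^sub>-\<close> remains to be computed.\<close>

section \<open>The eigenvalue problem of a single cell\<close>

text \<open>Cramer's rule gives one direction: the determinant times either unknown is a combination
  of the two equations. Conversely, \<open>(b, - a)\<close> solves the system when the first row is
  nonzero, and \<open>(d, - c)\<close> when only the second is.\<close>

lemma nontrivial_kernel_2x2_iff:
  fixes a b c d :: "'a :: field"
  shows "(\<exists>x y. (x \<noteq> 0 \<or> y \<noteq> 0) \<and> a * x + b * y = 0 \<and> c * x + d * y = 0)
    \<longleftrightarrow> a * d - b * c = 0" (is "?L \<longleftrightarrow> ?R")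
proof
  assume ?L
  then obtain x y where nz: "x \<noteq> 0 \<or> y \<noteq> 0"
    and e1: "a * x + b * y = 0" and e2: "c * x + d * y = 0" by blast
  have "(a * d - b * c) * x = d * (a * x + b * y) - b * (c * x + d * y)"
    by (simp add: algebra_simps)
  moreover have "(a * d - b * c) * y = a * (c * x + d * y) - c * (a * x + b * y)"
    by (simp add: algebra_simps)
  ultimately show ?R using nz e1 e2 by auto
next
  assume R: ?R
  show ?L
  proof (cases "a = 0 \<and> b = 0")
    case True
    show ?thesis
    proof (cases "c = 0 \<and> d = 0")
      case True
      with \<open>a = 0 \<and> b = 0\<close> show ?thesis by (intro exI[of _ 1]) auto
    next
      case False
      with \<open>a = 0 \<and> b = 0\<close> show ?thesis
        by (intro exI[of _ d] exI[of _ "- c"]) (auto simp: algebra_simps)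
    qed
  next
    case False
    with R show ?thesis
      by (intro exI[of _ b] exI[of _ "- a"]) (auto simp: algebra_simps)
  qed
qed

text \<open>The eigenvalue equation of a 4x4 block in scalar form: \<open>p, q\<close> and
  \<open>r, s\<close> are the diagonals of \<open>\<L>\<^sub>+\<close> and
  \<open>\<L>\<^sub>-\<close> on the cell, \<open>- m\<close> is their common off-diagonal entry,
  and \<open>(xA, xB, yA, yB)\<close> is the eigenvector.\<close>

definition cell_eigenvalue ::
    "complex \<Rightarrow> complex \<Rightarrow> complex \<Rightarrow> complex \<Rightarrow> complex \<Rightarrow> complex \<Rightarrow> bool" where
  "cell_eigenvalue p q r s m z \<longleftrightarrow>
     (\<exists>xA xB yA yB. (xA \<noteq> 0 \<or> xB \<noteq> 0 \<or> yA \<noteq> 0 \<or> yB \<noteq> 0) \<and>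
        - (p * yA - m * yB) = z * xA \<and> - (q * yB - m * yA) = z * xB \<and>
        r * xA - m * xB = z * yA \<and> s * xB - m * xA = z * yB)"

lemma cell_eigenvalueI:
  assumes "xA \<noteq> 0 \<or> xB \<noteq> 0 \<or> yA \<noteq> 0 \<or> yB \<noteq> 0"
    and "- (p * yA - m * yB) = z * xA" "- (q * yB - m * yA) = z * xB"
    and "r * xA - m * xB = z * yA" "s * xB - m * xA = z * yB"
  shows "cell_eigenvalue p q r s m z"
  using assms unfolding cell_eigenvalue_def by blast

text \<open>The characteristic polynomial of
  \<open>- \<L>\<^sub>+ \<L>\<^sub>-\<close> for \<open>\<L>\<^sub>+ = (p, -m; -m, q)\<close> and \<open>\<L>\<^sub>- = (r, -m; -m, s)\<close>, at \<open>z\<^sup>2\<close>.\<close>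

lemma cell_eigenvalue_iff:
  "cell_eigenvalue p q r s m z \<longleftrightarrow>
     z ^ 4 + (p * r + 2 * m\<^sup>2 + q * s) * z\<^sup>2 + (p * q - m\<^sup>2) * (r * s - m\<^sup>2) = 0"
proof (cases "z = 0")
  case True
  \<comment> \<open>At zero the two halves decouple: \<open>y\<close> lies in the kernel of
    \<open>\<L>\<^sub>+\<close> and \<open>x\<close> in that of \<open>\<L>\<^sub>-\<close>, so one
    of the two determinants must vanish.\<close>
  have "cell_eigenvalue p q r s m 0 \<longleftrightarrow>
      (\<exists>x y. (x \<noteq> 0 \<or> y \<noteq> 0) \<and> p * x + (- m) * y = 0 \<and> (- m) * x + q * y = 0) \<or>
      (\<exists>x y. (x \<noteq> 0 \<or> y \<noteq> 0) \<and> r * x + (- m) * y = 0 \<and> (- m) * x + s * y = 0)"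
    (is "_ \<longleftrightarrow> ?P \<or> ?Q")
  proof
    assume "cell_eigenvalue p q r s m 0"
    then obtain xA xB yA yB where nz: "xA \<noteq> 0 \<or> xB \<noteq> 0 \<or> yA \<noteq> 0 \<or> yB \<noteq> 0"
      and "- (p * yA - m * yB) = 0" "- (q * yB - m * yA) = 0"
        "r * xA - m * xB = 0" "s * xB - m * xA = 0"
      unfolding cell_eigenvalue_def mult_zero_left by blast
    then have "p * yA + (- m) * yB = 0" "(- m) * yA + q * yB = 0"
        "r * xA + (- m) * xB = 0" "(- m) * xA + s * xB = 0"
      by simp_all
    with nz show "?P \<or> ?Q" by blast
  next
    assume "?P \<or> ?Q"
    then show "cell_eigenvalue p q r s m 0"
    proof
      assume ?P
      then obtain x y where "x \<noteq> 0 \<or> y \<noteq> 0" "p * x + (- m) * y = 0" "(- m) * x + q * y = 0"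
        by blast
      then show ?thesis
        by (intro cell_eigenvalueI[of 0 0 x y]) auto
    next
      assume ?Q
      then obtain x y where "x \<noteq> 0 \<or> y \<noteq> 0" "r * x + (- m) * y = 0" "(- m) * x + s * y = 0"
        by blast
      then show ?thesis
        by (intro cell_eigenvalueI[of x y 0 0]) auto
    qed
  qed
  also have "\<dots> \<longleftrightarrow> (p * q - m\<^sup>2) * (r * s - m\<^sup>2) = 0"
    unfolding nontrivial_kernel_2x2_iff by (simp add: power2_eq_square)
  finally show ?thesis using True by simp
next
  case False
  \<comment> \<open>These are the entries of \<open>z\<^sup>2 + \<L>\<^sub>+ \<L>\<^sub>-\<close>.
    For nonzero \<open>z\<close> the last two equations force \<open>y = \<L>\<^sub>- x / z\<close>,
    and inserting this into the first two leaves a kernel condition on \<open>x\<close>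
    alone.\<close>
  let ?a = "z\<^sup>2 + p * r + m\<^sup>2" and ?b = "- m * (p + s)"
    and ?c = "- m * (q + r)" and ?d = "z\<^sup>2 + q * s + m\<^sup>2"
  have "cell_eigenvalue p q r s m z \<longleftrightarrow>
      (\<exists>x y. (x \<noteq> 0 \<or> y \<noteq> 0) \<and> ?a * x + ?b * y = 0 \<and> ?c * x + ?d * y = 0)" (is "_ \<longleftrightarrow> ?P")
  proof
    assume "cell_eigenvalue p q r s m z"
    then obtain xA xB yA yB where nz: "xA \<noteq> 0 \<or> xB \<noteq> 0 \<or> yA \<noteq> 0 \<or> yB \<noteq> 0"
      and e: "- (p * yA - m * yB) = z * xA" "- (q * yB - m * yA) = z * xB"
        "r * xA - m * xB = z * yA" "s * xB - m * xA = z * yB"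
      unfolding cell_eigenvalue_def by blast
    have "?a * xA + ?b * xB = z * (z * xA) + p * (r * xA - m * xB) - m * (s * xB - m * xA)"
      by (simp add: algebra_simps power2_eq_square)
    also have "\<dots> = 0" unfolding e(3,4) e(1)[symmetric] by (simp add: algebra_simps)
    finally have 1: "?a * xA + ?b * xB = 0" .
    have "?c * xA + ?d * xB = z * (z * xB) + q * (s * xB - m * xA) - m * (r * xA - m * xB)"
      by (simp add: algebra_simps power2_eq_square)
    also have "\<dots> = 0" unfolding e(3,4) e(2)[symmetric] by (simp add: algebra_simps)
    finally have 2: "?c * xA + ?d * xB = 0" .
    \<comment> \<open>If \<open>x\<close> vanished, \<open>z y = 0\<close> would make
      \<open>y\<close> vanish as well.\<close>
    have "xA \<noteq> 0 \<or> xB \<noteq> 0" using nz e(3,4) False by auto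
    with 1 2 show ?P by blast
  next
    assume ?P
    then obtain x y where nz: "x \<noteq> 0 \<or> y \<noteq> 0"
      and e: "?a * x + ?b * y = 0" "?c * x + ?d * y = 0" by blast
    have 1: "p * (r * x - m * y) - m * (s * y - m * x) = - z\<^sup>2 * x"
      using e(1) by (simp add: algebra_simps power2_eq_square add_eq_0_iff)
    have 2: "q * (s * y - m * x) - m * (r * x - m * y) = - z\<^sup>2 * y"
      using e(2) by (simp add: algebra_simps power2_eq_square add_eq_0_iff)
    show "cell_eigenvalue p q r s m z"
    proof (rule cell_eigenvalueI[of x y "(r * x - m * y) / z" "(s * y - m * x) / z"])
      have "p * ((r * x - m * y) / z) - m * ((s * y - m * x) / z)
          = (p * (r * x - m * y) - m * (s * y - m * x)) / z"
        using False by (simp add: field_simps)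
      then show "- (p * ((r * x - m * y) / z) - m * ((s * y - m * x) / z)) = z * x"
        unfolding 1 using False by (simp add: power2_eq_square)
      have "q * ((s * y - m * x) / z) - m * ((r * x - m * y) / z)
          = (q * (s * y - m * x) - m * (r * x - m * y)) / z"
        using False by (simp add: field_simps)
      then show "- (q * ((s * y - m * x) / z) - m * ((r * x - m * y) / z)) = z * y"
        unfolding 2 using False by (simp add: power2_eq_square)
    qed (use nz False in auto)
  qed
  also have "\<dots> \<longleftrightarrow> ?a * ?d - ?b * ?c = 0"
    by (rule nontrivial_kernel_2x2_iff)
  also have "?a * ?d - ?b * ?c
      = z ^ 4 + (p * r + 2 * m\<^sup>2 + q * s) * z\<^sup>2 + (p * q - m\<^sup>2) * (r * s - m\<^sup>2)"
    by (simp add: algebra_simps power2_eq_square power4_eq_xxxx)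
  finally show ?thesis .
qed

section \<open>From the full stability matrix to its cells\<close>

text \<open>The block matrix sends \<open>(x, y)\<close> to \<open>(- B y, C x)\<close>, so the
  eigenvector equation splits into one equation for each half.\<close>

lemma eigenvalue_antidiagonal_block_iff:
  fixes B C :: "'a :: comm_ring_1 mat"
  assumes B: "B \<in> carrier_mat n n" and C: "C \<in> carrier_mat n n"
  shows "eigenvalue (four_block_mat (0\<^sub>m n n) (- B) C (0\<^sub>m n n)) z \<longleftrightarrow>
    (\<exists>x\<in>carrier_vec n. \<exists>y\<in>carrier_vec n. (x \<noteq> 0\<^sub>v n \<or> y \<noteq> 0\<^sub>v n) \<and>
       - (B *\<^sub>v y) = z \<cdot>\<^sub>v x \<and> C *\<^sub>v x = z \<cdot>\<^sub>v y)"
proof -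
  let ?M = "four_block_mat (0\<^sub>m n n) (- B) C (0\<^sub>m n n)"
  have ev: "eigenvector ?M (x @\<^sub>v y) z \<longleftrightarrow>
      (x \<noteq> 0\<^sub>v n \<or> y \<noteq> 0\<^sub>v n) \<and> - (B *\<^sub>v y) = z \<cdot>\<^sub>v x \<and> C *\<^sub>v x = z \<cdot>\<^sub>v y"
    if x: "x \<in> carrier_vec n" and y: "y \<in> carrier_vec n" for x y
  proof -
    have mv: "?M *\<^sub>v (x @\<^sub>v y) = (- (B *\<^sub>v y)) @\<^sub>v (C *\<^sub>v x)"
      using B C x y
      by (subst four_block_mat_mult_vec[OF zero_carrier_mat uminus_carrier_mat[OF B] C zero_carrier_mat x y])
        auto
    have sm: "z \<cdot>\<^sub>v (x @\<^sub>v y) = (z \<cdot>\<^sub>v x) @\<^sub>v (z \<cdot>\<^sub>v y)"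
      using x y by (intro eq_vecI) auto
    have zero: "0\<^sub>v (n + n) = 0\<^sub>v n @\<^sub>v (0\<^sub>v n :: 'a vec)"
      by (intro eq_vecI) auto
    have neq: "x @\<^sub>v y \<noteq> 0\<^sub>v (n + n) \<longleftrightarrow> x \<noteq> 0\<^sub>v n \<or> y \<noteq> 0\<^sub>v n"
      unfolding zero using x y by (subst append_vec_eq[of _ n]) auto
    have dim: "dim_row ?M = n + n" using B C by simp
    have "- (B *\<^sub>v y) @\<^sub>v C *\<^sub>v x = (z \<cdot>\<^sub>v x) @\<^sub>v (z \<cdot>\<^sub>v y) \<longleftrightarrow>
        - (B *\<^sub>v y) = z \<cdot>\<^sub>v x \<and> C *\<^sub>v x = z \<cdot>\<^sub>v y"
      using mult_mat_vec_carrier[OF B y] x by (intro append_vec_eq[of _ n]) auto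
    then show ?thesis
      unfolding eigenvector_def dim mv sm neq using x y by auto
  qed
  have "eigenvalue ?M z \<longleftrightarrow> (\<exists>v\<in>carrier_vec (n + n). eigenvector ?M v z)"
    unfolding eigenvalue_def eigenvector_def using B C by auto
  \<comment> \<open>Every vector of length \<open>n + n\<close> is a concatenation of two halves;
    \<open>all_vec_append\<close> is a universal statement, hence the negated predicate.\<close>
  also have "\<dots> \<longleftrightarrow> (\<exists>x\<in>carrier_vec n. \<exists>y\<in>carrier_vec n. eigenvector ?M (x @\<^sub>v y) z)"
    using all_vec_append[of n n "\<lambda>v. \<not> eigenvector ?M v z"] by blast
  finally show ?thesis using ev by blast
qed

lemma lin_mat_carrier [simp]:
  "lin_mat s L m g \<omega> \<phi> \<in> carrier_mat (2 * L) (2 * L)"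
  by (simp add: lin_mat_def)

text \<open>A diagonal entry of \<open>\<L>\<^sub>+\<close> (\<open>s = 1\<close>) or
  \<open>\<L>\<^sub>-\<close> (\<open>s = - 1\<close>), to which the hopping contributes nothing. It
  is complex because the eigenvectors are.\<close>

definition lin_diag :: "real \<Rightarrow> real \<Rightarrow> real \<Rightarrow> (site \<Rightarrow> real) \<Rightarrow> site \<Rightarrow> complex" where
  "lin_diag s g \<omega> \<phi> a = complex_of_real ((2 + s) * g * (\<phi> a)\<^sup>2 - \<omega>)"

text \<open>Index \<open>j\<close> belongs to cell \<open>j div 2\<close>, and entries between
  different cells vanish. Hence in rows \<open>2 * R\<close> and \<open>Suc (2 * R)\<close> only the
  two columns with the same indices survive.\<close>

lemma lin_mat_mult_vec:
  fixes s m g \<omega> :: real and \<phi> :: "site \<Rightarrow> real"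
  assumes R: "R < L" and v: "v \<in> carrier_vec (2 * L)"
  defines "M \<equiv> map_mat complex_of_real (lin_mat s L m g \<omega> \<phi>)"
  shows "(M *\<^sub>v v) $ (2 * R) = lin_diag s g \<omega> \<phi> (R, SubA) * v $ (2 * R) - m * v $ Suc (2 * R)"
    and "(M *\<^sub>v v) $ Suc (2 * R) = lin_diag s g \<omega> \<phi> (R, SubB) * v $ Suc (2 * R) - m * v $ (2 * R)"
proof -
  have row: "(M *\<^sub>v v) $ i =
      lin_entry s m g \<omega> \<phi> (site_of i) (site_of (2 * R)) * v $ (2 * R) +
      lin_entry s m g \<omega> \<phi> (site_of i) (site_of (Suc (2 * R))) * v $ Suc (2 * R)"
    if i: "i div 2 = R" for i
  proof -
    have iL: "i < 2 * L" using i R by auto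
    have "(M *\<^sub>v v) $ i =
        (\<Sum>j\<in>{0..<2 * L}. complex_of_real (lin_entry s m g \<omega> \<phi> (site_of i) (site_of j)) * v $ j)"
      using v iL by (simp add: M_def lin_mat_def scalar_prod_def)
    also have "\<dots> = (\<Sum>j\<in>{2 * R, Suc (2 * R)}.
        complex_of_real (lin_entry s m g \<omega> \<phi> (site_of i) (site_of j)) * v $ j)"
    proof (intro sum.mono_neutral_right ballI)
      fix j assume "j \<in> {0..<2 * L} - {2 * R, Suc (2 * R)}"
      then have "j div 2 \<noteq> i div 2" unfolding i by auto
      then have "lin_entry s m g \<omega> \<phi> (site_of i) (site_of j) = 0"
        by (auto simp: lin_entry_def hopping_def site_of_def)
      then show "complex_of_real (lin_entry s m g \<omega> \<phi> (site_of i) (site_of j)) * v $ j = 0"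
        by simp
    qed (use R in auto)
    finally show ?thesis by simp
  qed
  show "(M *\<^sub>v v) $ (2 * R) = lin_diag s g \<omega> \<phi> (R, SubA) * v $ (2 * R) - m * v $ Suc (2 * R)"
    by (subst row) (auto simp: lin_entry_def hopping_def site_of_def lin_diag_def)
  show "(M *\<^sub>v v) $ Suc (2 * R) = lin_diag s g \<omega> \<phi> (R, SubB) * v $ Suc (2 * R) - m * v $ (2 * R)"
    by (subst row) (auto simp: lin_entry_def hopping_def site_of_def lin_diag_def)
qed

lemma vec_eq_cellwise_iff:
  assumes "v \<in> carrier_vec (2 * L)" "w \<in> carrier_vec (2 * L)"
  shows "v = w \<longleftrightarrow> (\<forall>R<L. v $ (2 * R) = w $ (2 * R) \<and> v $ Suc (2 * R) = w $ Suc (2 * R))"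
    (is "_ \<longleftrightarrow> ?R")
proof
  assume R: ?R
  show "v = w"
  proof (rule eq_vecI)
    fix i assume "i < dim_vec w"
    then have i: "i div 2 < L" using assms by auto
    have "i = 2 * (i div 2) \<or> i = Suc (2 * (i div 2))" by presburger
    then show "v $ i = w $ i" using R i by metis
  qed (use assms in auto)
qed simp

text \<open>The spectrum of a direct sum is the union of the spectra of its summands: an eigenvector
  restricts to a cell on which it is nonzero, and an eigenvector of one cell extends by
  zero.\<close>

lemma stability_spectrum_cellwise:
  "stability_spectrum L m g \<omega> \<phi> =
    {z. \<exists>R<L. cell_eigenvalue (lin_diag 1 g \<omega> \<phi> (R, SubA)) (lin_diag 1 g \<omega> \<phi> (R, SubB))
      (lin_diag (- 1) g \<omega> \<phi> (R, SubA)) (lin_diag (- 1) g \<omega> \<phi> (R, SubB)) (complex_of_real m) z}"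
proof -
  let ?P = "map_mat complex_of_real (lin_mat 1 L m g \<omega> \<phi>)"
  let ?M = "map_mat complex_of_real (lin_mat (- 1) L m g \<omega> \<phi>)"
  \<comment> \<open>The four scalar equations of \<open>cell_eigenvalue\<close> on cell
    \<open>R\<close>.\<close>
  let ?E = "\<lambda>(z::complex) R (xA::complex) (xB::complex) (yA::complex) (yB::complex).
    - (lin_diag 1 g \<omega> \<phi> (R, SubA) * yA - m * yB) = z * xA \<and>
    - (lin_diag 1 g \<omega> \<phi> (R, SubB) * yB - m * yA) = z * xB \<and>
    lin_diag (- 1) g \<omega> \<phi> (R, SubA) * xA - m * xB = z * yA \<and>
    lin_diag (- 1) g \<omega> \<phi> (R, SubB) * xB - m * xA = z * yB"
  have block: "map_mat complex_of_real (stability_matrix L m g \<omega> \<phi>) =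
      four_block_mat (0\<^sub>m (2 * L) (2 * L)) (- ?P) ?M (0\<^sub>m (2 * L) (2 * L))"
    unfolding stability_matrix_def
    by (subst map_four_block_mat[OF zero_carrier_mat _ _ zero_carrier_mat])
      (auto simp: lin_mat_def intro!: cong_four_block_mat eq_matI)
  have eqs: "- (?P *\<^sub>v y) = z \<cdot>\<^sub>v x \<and> ?M *\<^sub>v x = z \<cdot>\<^sub>v y \<longleftrightarrow>
      (\<forall>R<L. ?E z R (x $ (2 * R)) (x $ Suc (2 * R)) (y $ (2 * R)) (y $ Suc (2 * R)))"
    if x: "x \<in> carrier_vec (2 * L)" and y: "y \<in> carrier_vec (2 * L)" for x y z
  proof -
    have Py: "?P *\<^sub>v y \<in> carrier_vec (2 * L)" and Mx: "?M *\<^sub>v x \<in> carrier_vec (2 * L)"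
      using mult_mat_vec_carrier[OF map_carrier_mat[THEN iffD2, OF lin_mat_carrier]] x y by blast+
    have lt: "Suc (2 * R) < 2 * L" "2 * R < 2 * L" if "R < L" for R using that by auto
    have minus: "(- (?P *\<^sub>v y)) $ i = - ((?P *\<^sub>v y) $ i)" if "i < 2 * L" for i
      using that carrier_vecD[OF Py] by (metis index_uminus_vec(1))
    have smult: "(z \<cdot>\<^sub>v x) $ i = z * x $ i" "(z \<cdot>\<^sub>v y) $ i = z * y $ i" if "i < 2 * L" for i
      using that carrier_vecD[OF x] carrier_vecD[OF y] by (metis index_smult_vec(1))+
    have "- (?P *\<^sub>v y) = z \<cdot>\<^sub>v x \<longleftrightarrow> (\<forall>R<L.
        - (lin_diag 1 g \<omega> \<phi> (R, SubA) * y $ (2 * R) - m * y $ Suc (2 * R)) = z * x $ (2 * R) \<and>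
        - (lin_diag 1 g \<omega> \<phi> (R, SubB) * y $ Suc (2 * R) - m * y $ (2 * R)) = z * x $ Suc (2 * R))"
      unfolding vec_eq_cellwise_iff[OF uminus_carrier_vec[THEN iffD2, OF Py] smult_carrier_vec[THEN iffD2, OF x]]
      by (simp only: minus smult lt lin_mat_mult_vec[OF _ y] cong: conj_cong imp_cong)
    moreover have "?M *\<^sub>v x = z \<cdot>\<^sub>v y \<longleftrightarrow> (\<forall>R<L.
        lin_diag (- 1) g \<omega> \<phi> (R, SubA) * x $ (2 * R) - m * x $ Suc (2 * R) = z * y $ (2 * R) \<and>
        lin_diag (- 1) g \<omega> \<phi> (R, SubB) * x $ Suc (2 * R) - m * x $ (2 * R) = z * y $ Suc (2 * R))"
      unfolding vec_eq_cellwise_iff[OF Mx smult_carrier_vec[THEN iffD2, OF y]]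
      by (simp only: smult lt lin_mat_mult_vec[OF _ x] cong: conj_cong imp_cong)
    ultimately show ?thesis by blast
  qed
  have "eigenvalue (map_mat complex_of_real (stability_matrix L m g \<omega> \<phi>)) z \<longleftrightarrow>
      (\<exists>R<L. cell_eigenvalue (lin_diag 1 g \<omega> \<phi> (R, SubA)) (lin_diag 1 g \<omega> \<phi> (R, SubB))
      (lin_diag (- 1) g \<omega> \<phi> (R, SubA)) (lin_diag (- 1) g \<omega> \<phi> (R, SubB)) (complex_of_real m) z)"
    (is "?L \<longleftrightarrow> ?R") for z
  proof -
    have "?L \<longleftrightarrow> (\<exists>x\<in>carrier_vec (2 * L). \<exists>y\<in>carrier_vec (2 * L).
        (x \<noteq> 0\<^sub>v (2 * L) \<or> y \<noteq> 0\<^sub>v (2 * L)) \<and>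
        (\<forall>R<L. ?E z R (x $ (2 * R)) (x $ Suc (2 * R)) (y $ (2 * R)) (y $ Suc (2 * R))))"
      unfolding block by (subst eigenvalue_antidiagonal_block_iff) (auto simp: eqs)
    also have "\<dots> \<longleftrightarrow> ?R"
    proof
      assume "\<exists>x\<in>carrier_vec (2 * L). \<exists>y\<in>carrier_vec (2 * L).
        (x \<noteq> 0\<^sub>v (2 * L) \<or> y \<noteq> 0\<^sub>v (2 * L)) \<and>
        (\<forall>R<L. ?E z R (x $ (2 * R)) (x $ Suc (2 * R)) (y $ (2 * R)) (y $ Suc (2 * R)))"
      then obtain x y where x: "x \<in> carrier_vec (2 * L)" and y: "y \<in> carrier_vec (2 * L)"
        and nz: "x \<noteq> 0\<^sub>v (2 * L) \<or> y \<noteq> 0\<^sub>v (2 * L)"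
        and E: "\<And>R. R < L \<Longrightarrow> ?E z R (x $ (2 * R)) (x $ Suc (2 * R)) (y $ (2 * R)) (y $ Suc (2 * R))"
        by blast
      have "\<exists>R<L. x $ (2 * R) \<noteq> 0 \<or> x $ Suc (2 * R) \<noteq> 0 \<or> y $ (2 * R) \<noteq> 0 \<or> y $ Suc (2 * R) \<noteq> 0"
        using nz unfolding vec_eq_cellwise_iff[OF x zero_carrier_vec]
          vec_eq_cellwise_iff[OF y zero_carrier_vec] by fastforce
      then obtain R where R: "R < L" and
        "x $ (2 * R) \<noteq> 0 \<or> x $ Suc (2 * R) \<noteq> 0 \<or> y $ (2 * R) \<noteq> 0 \<or> y $ Suc (2 * R) \<noteq> 0" by blast
      with E[OF R] show ?R by (blast intro: cell_eigenvalueI)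
    next
      assume ?R
      then obtain R xA xB yA yB where R: "R < L"
        and nz: "xA \<noteq> 0 \<or> xB \<noteq> 0 \<or> yA \<noteq> 0 \<or> yB \<noteq> 0" and E: "?E z R xA xB yA yB"
        unfolding cell_eigenvalue_def by blast
      \<comment> \<open>Extension by zero from cell \<open>R\<close>; on every other cell the
        equations read \<open>0 = 0\<close>.\<close>
      let ?x = "vec (2 * L) (\<lambda>i. if i = 2 * R then xA else if i = Suc (2 * R) then xB else 0)"
      let ?y = "vec (2 * L) (\<lambda>i. if i = 2 * R then yA else if i = Suc (2 * R) then yB else 0)"
      have lt: "Suc (2 * R') < 2 * L" "2 * R' < 2 * L" if "R' < L" for R' using that by auto
      \<comment> \<open>An A index is even and a B index odd, so the cell label alone decides the
        conditionals in \<open>?x\<close> and \<open>?y\<close>.\<close>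
      have parity: "Suc (2 * a) \<noteq> 2 * b" "2 * b \<noteq> Suc (2 * a)" for a b :: nat by presburger+
      have "?x \<noteq> 0\<^sub>v (2 * L) \<or> ?y \<noteq> 0\<^sub>v (2 * L)"
      proof (rule ccontr)
        assume "\<not> ?thesis"
        then have "?x $ (2 * R) = 0" "?x $ Suc (2 * R) = 0" "?y $ (2 * R) = 0" "?y $ Suc (2 * R) = 0"
          using lt[OF R] by (simp_all only: index_zero_vec not_not de_Morgan_disj)
        then show False using nz lt[OF R] by simp
      qed
      moreover have "?E z R' (?x $ (2 * R')) (?x $ Suc (2 * R')) (?y $ (2 * R')) (?y $ Suc (2 * R'))"
        if "R' < L" for R'
        using lt[OF that] E by (cases "R' = R") (simp_all add: parity)
      ultimately show "\<exists>x\<in>carrier_vec (2 * L). \<exists>y\<in>carrier_vec (2 * L).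
        (x \<noteq> 0\<^sub>v (2 * L) \<or> y \<noteq> 0\<^sub>v (2 * L)) \<and>
        (\<forall>R<L. ?E z R (x $ (2 * R)) (x $ Suc (2 * R)) (y $ (2 * R)) (y $ Suc (2 * R)))"
        using vec_carrier by blast
    qed
    finally show ?thesis .
  qed
  then show ?thesis unfolding stability_spectrum_def spectrum_def by (intro Collect_cong)
qed

section \<open>Roots of the cell polynomials and the spectrum of a one-cell breather\<close>

lemma square_plus_square_eq_0_iff:
  fixes z c :: complex
  shows "z\<^sup>2 + c\<^sup>2 = 0 \<longleftrightarrow> z = \<i> * c \<or> z = - \<i> * c"
proof -
  have "z\<^sup>2 + c\<^sup>2 = (z - \<i> * c) * (z + \<i> * c)"
    by (simp add: algebra_simps power2_eq_square)
  then show ?thesis by (simp add: eq_neg_iff_add_eq_0)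
qed

text \<open>Both signs occur, so the choice of the branch of the square root is immaterial;
  \<open>c\<close> may be any complex number, in particular a negative real.\<close>

lemma square_plus_eq_0_iff:
  fixes z c :: complex
  shows "z\<^sup>2 + c = 0 \<longleftrightarrow> z = \<i> * csqrt c \<or> z = - \<i> * csqrt c"
  using square_plus_square_eq_0_iff[of z "csqrt c"] by simp

text \<open>By \<open>det\<close>, the determinant of \<open>\<L>\<^sub>-\<close> on the occupied
  cell is zero, as it must be when \<open>\<L>\<^sub>-\<close> annihilates a nonzero vector there.
  The cell polynomial is then \<open>z\<^sup>2 * (z\<^sup>2 + T)\<close>, where \<open>T\<close> is
  the trace of \<open>\<L>\<^sub>+ \<L>\<^sub>-\<close>. The values built from
  \<open>\<omega> - m\<close> and \<open>\<omega> + m\<close> come from the empty cells, of which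
  \<open>L \<ge> 2\<close> provides at least one.\<close>

lemma stability_spectrum_single_cell:
  fixes m g \<omega> :: real
  assumes L: "L \<ge> 2" and R0: "R\<^sub>0 < L"
    and \<phi>: "\<And>R \<alpha>. R < L \<Longrightarrow> \<phi> (R, \<alpha>) = (if R = R\<^sub>0 then \<phi>c \<alpha> else 0)"
    and det: "(g * (\<phi>c SubA)\<^sup>2 - \<omega>) * (g * (\<phi>c SubB)\<^sup>2 - \<omega>) = m\<^sup>2"
    and T: "(3 * g * (\<phi>c SubA)\<^sup>2 - \<omega>) * (g * (\<phi>c SubA)\<^sup>2 - \<omega>) + 2 * m\<^sup>2 +
            (3 * g * (\<phi>c SubB)\<^sup>2 - \<omega>) * (g * (\<phi>c SubB)\<^sup>2 - \<omega>) = T"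
  shows "stability_spectrum L m g \<omega> \<phi> =
          {0, \<i> * csqrt (complex_of_real T), - \<i> * csqrt (complex_of_real T),
           \<i> * complex_of_real (\<omega> - m), - \<i> * complex_of_real (\<omega> - m),
           \<i> * complex_of_real (\<omega> + m), - \<i> * complex_of_real (\<omega> + m)}"
proof -
  let ?C = "\<lambda>R. cell_eigenvalue (lin_diag 1 g \<omega> \<phi> (R, SubA)) (lin_diag 1 g \<omega> \<phi> (R, SubB))
      (lin_diag (- 1) g \<omega> \<phi> (R, SubA)) (lin_diag (- 1) g \<omega> \<phi> (R, SubB)) (complex_of_real m)"
  have empty: "?C R z \<longleftrightarrow> z \<in> {\<i> * complex_of_real (\<omega> - m), - \<i> * complex_of_real (\<omega> - m),
      \<i> * complex_of_real (\<omega> + m), - \<i> * complex_of_real (\<omega> + m)}"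
    if "R < L" "R \<noteq> R\<^sub>0" for R z
  proof -
    have "lin_diag s g \<omega> \<phi> (R, \<alpha>) = - complex_of_real \<omega>" for s \<alpha>
      using that by (simp add: lin_diag_def \<phi>)
    then have "?C R z \<longleftrightarrow> z ^ 4 + (2 * complex_of_real \<omega> ^ 2 + 2 * complex_of_real m ^ 2) * z\<^sup>2 +
        (complex_of_real \<omega> ^ 2 - complex_of_real m ^ 2)\<^sup>2 = 0"
      unfolding cell_eigenvalue_iff by (simp add: power2_eq_square algebra_simps)
    \<comment> \<open>On an empty cell both operators equal the hopping minus
      \<open>\<omega>\<close>, with eigenvalues \<open>m - \<omega>\<close> and
      \<open>- m - \<omega>\<close>; each contributes one quadratic factor.\<close>
    also have "z ^ 4 + (2 * complex_of_real \<omega> ^ 2 + 2 * complex_of_real m ^ 2) * z\<^sup>2 +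
        (complex_of_real \<omega> ^ 2 - complex_of_real m ^ 2)\<^sup>2 =
        (z\<^sup>2 + (complex_of_real (\<omega> - m))\<^sup>2) * (z\<^sup>2 + (complex_of_real (\<omega> + m))\<^sup>2)"
      by (simp add: power2_eq_square power4_eq_xxxx algebra_simps)
    finally show ?thesis
      by (simp only: mult_eq_0_iff square_plus_square_eq_0_iff insert_iff empty_iff) blast
  qed
  have occupied: "?C R\<^sub>0 z \<longleftrightarrow>
      z \<in> {0, \<i> * csqrt (complex_of_real T), - \<i> * csqrt (complex_of_real T)}" for z
  proof -
    let ?p = "\<lambda>\<alpha>. 3 * g * (\<phi>c \<alpha>)\<^sup>2 - \<omega>" and ?r = "\<lambda>\<alpha>. g * (\<phi>c \<alpha>)\<^sup>2 - \<omega>"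
    have p: "lin_diag 1 g \<omega> \<phi> (R\<^sub>0, \<alpha>) = complex_of_real (?p \<alpha>)"
      and r: "lin_diag (- 1) g \<omega> \<phi> (R\<^sub>0, \<alpha>) = complex_of_real (?r \<alpha>)" for \<alpha>
      using R0 by (simp_all add: lin_diag_def \<phi>)
    have "complex_of_real (?r SubA) * complex_of_real (?r SubB) - (complex_of_real m)\<^sup>2 = 0"
      unfolding of_real_mult[symmetric] det by simp
    moreover have "complex_of_real (?p SubA) * complex_of_real (?r SubA) + 2 * (complex_of_real m)\<^sup>2 +
        complex_of_real (?p SubB) * complex_of_real (?r SubB) = complex_of_real T"
      unfolding T[symmetric] by simp
    ultimately have "?C R\<^sub>0 z \<longleftrightarrow> z ^ 4 + complex_of_real T * z\<^sup>2 = 0"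
      unfolding p r cell_eigenvalue_iff by (simp only: mult_zero_right add_0_right)
    also have "z ^ 4 + complex_of_real T * z\<^sup>2 = z\<^sup>2 * (z\<^sup>2 + complex_of_real T)"
      by (simp add: power2_eq_square power4_eq_xxxx algebra_simps)
    finally show ?thesis
      by (simp only: mult_eq_0_iff square_plus_eq_0_iff insert_iff empty_iff) simp
  qed
  \<comment> \<open>All empty cells have the same spectrum, so a single representative
    \<open>R1\<close> accounts for them.\<close>
  obtain R1 where R1: "R1 < L" "R1 \<noteq> R\<^sub>0"
    using L by (cases "R\<^sub>0 = 0") (force intro: that[of 1], force intro: that[of 0])
  have "(\<exists>R<L. ?C R z) \<longleftrightarrow> ?C R\<^sub>0 z \<or> ?C R1 z" for z
  proof
    assume "\<exists>R<L. ?C R z"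
    then obtain R where "R < L" "?C R z" by blast
    then show "?C R\<^sub>0 z \<or> ?C R1 z"
      using empty[of R z] empty[of R1 z] R1 by (cases "R = R\<^sub>0") auto
  qed (use R0 R1 in blast)
  then show ?thesis
    unfolding stability_spectrum_cellwise occupied empty[OF R1] by (auto simp only:)
qed

section \<open>The three families of breathers\<close>

theorem mainTheorem2:
  fixes m g \<omega> :: real and L R\<^sub>0 :: nat
    and \<phi> :: "site \<Rightarrow> real" and \<phi>c :: "sublattice \<Rightarrow> real"
  assumes "m > 0" and "g \<noteq> 0" and "L \<ge> 2"
    and "breather L m g \<omega> \<phi>"
    and "R\<^sub>0 < L"
    and "\<And>R \<alpha>. R < L \<Longrightarrow> \<phi> (R, \<alpha>) = (if R = R\<^sub>0 then \<phi>c \<alpha> else 0)"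
  shows
    "(\<bar>g\<bar> \<ge> 2 * m \<and> (\<phi>c SubA)\<^sup>2 + (\<phi>c SubB)\<^sup>2 = 1 \<and> \<phi>c SubA * \<phi>c SubB = - m / g \<and> \<omega> = g \<longrightarrow>
        stability_spectrum L m g \<omega> \<phi> =
          {0,
           \<i> * csqrt (complex_of_real (g\<^sup>2 - 4 * m\<^sup>2)), - \<i> * csqrt (complex_of_real (g\<^sup>2 - 4 * m\<^sup>2)),
           \<i> * complex_of_real (g - m), - \<i> * complex_of_real (g - m),
           \<i> * complex_of_real (g + m), - \<i> * complex_of_real (g + m)} \<and>
        linearly_stable L m g \<omega> \<phi>) \<and>
     (\<phi>c SubA = 1 / sqrt 2 \<and> \<phi>c SubB = 1 / sqrt 2 \<and> \<omega> = - m + g / 2 \<longrightarrow>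
        stability_spectrum L m g \<omega> \<phi> =
          {0,
           \<i> * csqrt (complex_of_real (2 * m * (2 * m + g))), - \<i> * csqrt (complex_of_real (2 * m * (2 * m + g))),
           \<i> * complex_of_real (g / 2 - 2 * m), - \<i> * complex_of_real (g / 2 - 2 * m),
           \<i> * complex_of_real (g / 2), - \<i> * complex_of_real (g / 2)} \<and>
        (g \<ge> - 2 * m \<longrightarrow> linearly_stable L m g \<omega> \<phi>) \<and>
        (g < - 2 * m \<longrightarrow> linearly_unstable L m g \<omega> \<phi>)) \<and>
     (\<phi>c SubA = 1 / sqrt 2 \<and> \<phi>c SubB = - 1 / sqrt 2 \<and> \<omega> = m + g / 2 \<longrightarrow>
        stability_spectrum L m g \<omega> \<phi> =
          {0,
           \<i> * csqrt (complex_of_real (2 * m * (2 * m - g))), - \<i> * csqrt (complex_of_real (2 * m * (2 * m - g))),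
           \<i> * complex_of_real (g / 2 + 2 * m), - \<i> * complex_of_real (g / 2 + 2 * m),
           \<i> * complex_of_real (g / 2), - \<i> * complex_of_real (g / 2)} \<and>
        (g \<le> 2 * m \<longrightarrow> linearly_stable L m g \<omega> \<phi>))"
proof (intro conjI impI; (elim conjE)?)
  note single = stability_spectrum_single_cell[OF assms(3,5,6)]
  {
    assume g: "2 * m \<le> \<bar>g\<bar>" and n: "(\<phi>c SubA)\<^sup>2 + (\<phi>c SubB)\<^sup>2 = 1"
      and p: "\<phi>c SubA * \<phi>c SubB = - m / g" and \<omega>: "\<omega> = g"
    have p2: "g\<^sup>2 * ((\<phi>c SubA)\<^sup>2 * (\<phi>c SubB)\<^sup>2) = m\<^sup>2"
      using assms(2) by (simp add: p power_divide power_mult_distrib[symmetric])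
        (simp add: power_mult_distrib)
    have B: "(\<phi>c SubB)\<^sup>2 = 1 - (\<phi>c SubA)\<^sup>2" using n by simp
    show S: "stability_spectrum L m g \<omega> \<phi> =
          {0,
           \<i> * csqrt (complex_of_real (g\<^sup>2 - 4 * m\<^sup>2)), - \<i> * csqrt (complex_of_real (g\<^sup>2 - 4 * m\<^sup>2)),
           \<i> * complex_of_real (g - m), - \<i> * complex_of_real (g - m),
           \<i> * complex_of_real (g + m), - \<i> * complex_of_real (g + m)}"
      unfolding \<omega>
    proof (rule single)
      \<comment> \<open>With \<open>a\<close>, \<open>b\<close> the squared amplitudes and
        \<open>a + b = 1\<close>, the left side is
        \<open>g\<^sup>2 * (1 - a) * (1 - b) = g\<^sup>2 * a * b\<close>, which is
        \<open>m\<^sup>2\<close> by \<open>p2\<close>.\<close>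
      show "(g * (\<phi>c SubA)\<^sup>2 - g) * (g * (\<phi>c SubB)\<^sup>2 - g) = m\<^sup>2"
        unfolding p2[symmetric] B by (simp add: power2_eq_square algebra_simps)
      \<comment> \<open>In the same notation the two products add up to
        \<open>g\<^sup>2 * (1 - 6 * a * b) = g\<^sup>2 - 6 * m\<^sup>2\<close>.\<close>
      show "(3 * g * (\<phi>c SubA)\<^sup>2 - g) * (g * (\<phi>c SubA)\<^sup>2 - g) + 2 * m\<^sup>2 +
          (3 * g * (\<phi>c SubB)\<^sup>2 - g) * (g * (\<phi>c SubB)\<^sup>2 - g) = g\<^sup>2 - 4 * m\<^sup>2"
        unfolding p2[symmetric] B by (simp add: power2_eq_square algebra_simps)
    qed
    have "(2 * m)\<^sup>2 \<le> g\<^sup>2"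
      using g assms(1) by (metis abs_le_square_iff abs_of_pos mult_pos_pos zero_less_numeral)
    then have "0 \<le> g\<^sup>2 - 4 * m\<^sup>2" by (simp add: power_mult_distrib)
    \<comment> \<open>The square root of a nonnegative real is real, so multiplication by
      \<open>\<i>\<close> puts every listed value on the imaginary axis.\<close>
    then show "linearly_stable L m g \<omega> \<phi>"
      unfolding linearly_stable_def S by (simp del: of_real_diff)
  next
    assume A: "\<phi>c SubA = 1 / sqrt 2" and B: "\<phi>c SubB = 1 / sqrt 2" and \<omega>: "\<omega> = - m + g / 2"
    have sq: "(\<phi>c SubA)\<^sup>2 = 1 / 2" "(\<phi>c SubB)\<^sup>2 = 1 / 2"
      by (simp_all add: A B power_divide)
    have "stability_spectrum L m g \<omega> \<phi> =
          {0,
           \<i> * csqrt (complex_of_real (2 * m * (2 * m + g))), - \<i> * csqrt (complex_of_real (2 * m * (2 * m + g))),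
           \<i> * complex_of_real (\<omega> - m), - \<i> * complex_of_real (\<omega> - m),
           \<i> * complex_of_real (\<omega> + m), - \<i> * complex_of_real (\<omega> + m)}"
      \<comment> \<open>Here \<open>\<L>\<^sub>-\<close> has diagonal \<open>m\<close> and
        \<open>\<L>\<^sub>+\<close> has diagonal \<open>g + m\<close>, so the trace is
        \<open>2 * m * (g + m) + 2 * m\<^sup>2\<close>.\<close>
      by (rule single; simp only: sq \<omega>) (simp_all add: power2_eq_square algebra_simps)
    moreover have "\<omega> - m = g / 2 - 2 * m" "\<omega> + m = g / 2" using \<omega> by simp_all
    ultimately show S: "stability_spectrum L m g \<omega> \<phi> =
          {0,
           \<i> * csqrt (complex_of_real (2 * m * (2 * m + g))), - \<i> * csqrt (complex_of_real (2 * m * (2 * m + g))),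
           \<i> * complex_of_real (g / 2 - 2 * m), - \<i> * complex_of_real (g / 2 - 2 * m),
           \<i> * complex_of_real (g / 2), - \<i> * complex_of_real (g / 2)}" by simp
    show "linearly_stable L m g \<omega> \<phi>" if "g \<ge> - 2 * m"
    proof -
      have "2 * m * (2 * m + g) \<ge> 0" using that assms(1) by simp
      then show ?thesis unfolding linearly_stable_def S by (simp del: of_real_mult of_real_add of_real_diff)
    qed
    show "linearly_unstable L m g \<omega> \<phi>" if "g < - 2 * m"
    proof -
      let ?T = "2 * m * (2 * m + g)"
      have T: "?T < 0" using that assms(1) by (intro mult_pos_neg) auto
      \<comment> \<open>For negative \<open>?T\<close> the principal root is
        \<open>\<i> * sqrt \<bar>?T\<bar>\<close>, so the factor \<open>- \<i>\<close> selects the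
        positive real eigenvalue.\<close>
      then have "Re (- \<i> * csqrt (complex_of_real ?T)) > 0"
        by (subst csqrt_of_real_nonpos) auto
      then show ?thesis unfolding linearly_unstable_def S by blast
    qed
  next
    assume A: "\<phi>c SubA = 1 / sqrt 2" and B: "\<phi>c SubB = - 1 / sqrt 2" and \<omega>: "\<omega> = m + g / 2"
    have sq: "(\<phi>c SubA)\<^sup>2 = 1 / 2" "(\<phi>c SubB)\<^sup>2 = 1 / 2"
      by (simp_all add: A B power_divide)
    have "stability_spectrum L m g \<omega> \<phi> =
          {0,
           \<i> * csqrt (complex_of_real (2 * m * (2 * m - g))), - \<i> * csqrt (complex_of_real (2 * m * (2 * m - g))),
           \<i> * complex_of_real (\<omega> - m), - \<i> * complex_of_real (\<omega> - m),
           \<i> * complex_of_real (\<omega> + m), - \<i> * complex_of_real (\<omega> + m)}"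
      \<comment> \<open>Now the diagonals are \<open>- m\<close> and \<open>g - m\<close>, so the
        trace is \<open>- 2 * m * (g - m) + 2 * m\<^sup>2\<close>.\<close>
      by (rule single; simp only: sq \<omega>) (simp_all add: power2_eq_square algebra_simps)
    moreover have "\<omega> - m = g / 2" "\<omega> + m = g / 2 + 2 * m" using \<omega> by simp_all
    ultimately show S: "stability_spectrum L m g \<omega> \<phi> =
          {0,
           \<i> * csqrt (complex_of_real (2 * m * (2 * m - g))), - \<i> * csqrt (complex_of_real (2 * m * (2 * m - g))),
           \<i> * complex_of_real (g / 2 + 2 * m), - \<i> * complex_of_real (g / 2 + 2 * m),
           \<i> * complex_of_real (g / 2), - \<i> * complex_of_real (g / 2)}" by auto
    show "linearly_stable L m g \<omega> \<phi>" if "g \<le> 2 * m"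
    proof -
      have "2 * m * (2 * m - g) \<ge> 0" using that assms(1) by simp
      then show ?thesis unfolding linearly_stable_def S by (simp del: of_real_mult of_real_add of_real_diff)
    qed
  }
qed

end
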